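(* Let $K:\mathbb{R}^m_{\ge0}\to\mathbb{S}^n_{\succeq0}$ be continuous with $K(x)\succ0$ for every $x\in\mathbb{R}^m_{>0}$, and let $Q\in\mathbb{R}^{n\times d}$ be a nonzero matrix. Define, for $x\in\mathbb{R}^m_{\ge0}$ and $\epsilon>0$, $$\psi(x):=\lambda_{\max}(QQ^\top,K(x)),\qquad \psi^\epsilon(x):=\lambda_{\max}(QQ^\top,K(x)+\epsilon I).$$ Then $\psi^\epsilon$ is continuous on $\mathbb{R}^m_{\ge0}$ for every $\epsilon>0$, and $\psi^\epsilon$ epi-converges to $\psi$ as $\epsilon\to0$.
   Context: $\mathbb{R}^m_{\ge0}$ and $\mathbb{R}^m_{>0}$ are the sets of vectors in $\mathbb{R}^m$ with nonnegative, respectively positive, components; $\mathbb{S}^n_{\succeq0}$ is the set of real symmetric positive semidefinite $n\times n$ matrices; $\mathrm{Ker}\,Y=\{v\in\mathbb{R}^n\mid Yv=0\}$. For $X,Y\in\mathbb{S}^n_{\succeq0}$, $$\lambda_{\max}(X,Y):=\begin{cases}\displaystyle\sup_{v\notin\mathrm{Ker}\,Y}\frac{v^\top Xv}{v^\top Yv} & (Y\neq0),\\ \infty & (X\neq0,\ Y=0),\\ 0 & (X=Y=0).\end{cases}$$ Epi-convergence: for $f:\mathbb{R}^m\to(-\infty,\infty]$, $\mathrm{epi} f=\{(x,\alpha)\in\mathbb{R}^m\times\mathbb{R}\mid f(x)\le\alpha\}$. A sequence $f^k$ epi-converges to $f$ if $\mathrm{epi} f^k$ converges to $\mathrm{epi}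 f$ in the Painlevé–Kuratowski sense, i.e. both the outer limit $\{z\mid\liminf_{k} d(z,\mathrm{epi} f^k)=0\}$ and the inner limit $\{z\mid\limsup_{k} d(z,\mathrm{epi} f^k)=0\}$ equal $\mathrm{epi} f$. A family indexed by $\epsilon>0$ epi-converges as $\epsilon\to0$ if it does so along every sequence $\epsilon_k\to0$ with $\epsilon_k>0$. Functions defined only on a subset of $\mathbb{R}^m$ are extended by $\infty$ outside it. *)

theory Defs
  imports "HOL-Analysis.Analysis"
begin

definition nonneg_vecs :: "(real ^ 'm) set" where
  "nonneg_vecs = {x. \<forall>i. 0 \<le> x $ i}"

definition pos_vecs :: "(real ^ 'm) set" where
  "pos_vecs = {x. \<forall>i. 0 < x $ i}"

definition psd :: "real ^ 'n ^ 'n \<Rightarrow> bool" where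
  "psd A \<longleftrightarrow> transpose A = A \<and> (\<forall>v. 0 \<le> v \<bullet> (A *v v))"

definition posdef :: "real ^ 'n ^ 'n \<Rightarrow> bool" where
  "posdef A \<longleftrightarrow> transpose A = A \<and> (\<forall>v. v \<noteq> 0 \<longrightarrow> 0 < v \<bullet> (A *v v))"

definition Ker :: "real ^ 'n ^ 'n \<Rightarrow> (real ^ 'n) set" where
  "Ker Y = {v. Y *v v = 0}"

(* Only meaningful for positive semidefinite X and Y; for these, v \<notin> Ker Y makes the
   denominator positive. *)
definition lambda_max :: "real ^ 'n ^ 'n \<Rightarrow> real ^ 'n ^ 'n \<Rightarrow> ereal" where
  "lambda_max X Y =
    (if Y \<noteq> 0 then (SUP v \<in> - Ker Y. ereal ((v \<bullet> (X *v v)) / (v \<bullet> (Y *v v))))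
     else if X \<noteq> 0 then \<infinity>
     else 0)"

definition psi :: "real ^ 'd ^ 'n \<Rightarrow> (real ^ 'm \<Rightarrow> real ^ 'n ^ 'n) \<Rightarrow> real ^ 'm \<Rightarrow> ereal" where
  "psi Q K x = lambda_max (Q ** transpose Q) (K x)"

definition psi_eps ::
  "real ^ 'd ^ 'n \<Rightarrow> (real ^ 'm \<Rightarrow> real ^ 'n ^ 'n) \<Rightarrow> real \<Rightarrow> real ^ 'm \<Rightarrow> ereal" where
  "psi_eps Q K \<epsilon> x = lambda_max (Q ** transpose Q) (K x + \<epsilon> *\<^sub>R mat 1)"

definition extend_infty :: "'a set \<Rightarrow> ('a \<Rightarrow> ereal) \<Rightarrow> 'a \<Rightarrow> ereal" where
  "extend_infty S f x = (if x \<in> S then f x else \<infinity>)"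

definition epi :: "('a \<Rightarrow> ereal) \<Rightarrow> ('a \<times> real) set" where
  "epi f = {(x, \<alpha>). f x \<le> ereal \<alpha>}"

(* infdist is not used here because infdist z {} = 0, whereas the distance to the empty set
   has to be \<infinity> in the definition of set limits. *)
definition dist_set :: "'a::metric_space \<Rightarrow> 'a set \<Rightarrow> ereal" where
  "dist_set z C = (INF y \<in> C. ereal (dist z y))"

definition outer_limit :: "(nat \<Rightarrow> 'a::metric_space set) \<Rightarrow> 'a set" where
  "outer_limit C = {z. liminf (\<lambda>k. dist_set z (C k)) = 0}"

definition inner_limit :: "(nat \<Rightarrow> 'a::metric_space set) \<Rightarrow> 'a set" where
  "inner_limit C = {z. limsup (\<lambda>k. dist_set z (C k)) = 0}"

definition PK_converges :: "(nat \<Rightarrow> 'a::metric_space set) \<Rightarrow> 'a set \<Rightarrow> bool" where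
  "PK_converges C D \<longleftrightarrow> outer_limit C = D \<and> inner_limit C = D"

definition epi_converges ::
  "(nat \<Rightarrow> 'a::metric_space \<Rightarrow> ereal) \<Rightarrow> ('a \<Rightarrow> ereal) \<Rightarrow> bool" where
  "epi_converges f g \<longleftrightarrow> PK_converges (\<lambda>k. epi (f k)) (epi g)"

definition epi_converges_at_0 ::
  "(real \<Rightarrow> 'a::metric_space \<Rightarrow> ereal) \<Rightarrow> ('a \<Rightarrow> ereal) \<Rightarrow> bool" where
  "epi_converges_at_0 f g \<longleftrightarrow>
    (\<forall>e :: nat \<Rightarrow> real. (\<forall>k. 0 < e k) \<and> e \<longlonglongrightarrow> 0 \<longrightarrow> epi_converges (\<lambda>k. f (e k)) g)"

end

theory Submission
  imports Defs
begin

text \<open>For positive semidefinite \<open>A \<noteq> 0\<close> and \<open>Y\<close>, the inequality \<open>lambda_max A Y \<le> \<alpha>\<close>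
  holds for a real \<open>\<alpha>\<close> iff \<open>v \<bullet> A v \<le> \<alpha> (v \<bullet> Y v)\<close> for \<^emph>\<open>all\<close> \<open>v\<close>, kernel vectors included.
  In this form the epigraphs of all \<open>\<psi>\<^sup>\<epsilon>\<close> (\<open>\<epsilon> > 0\<close>) and of \<open>\<psi>\<close> are the slices of a single
  closed set of triples \<open>(x, \<alpha>, \<epsilon>)\<close> with \<open>\<epsilon> \<ge> 0\<close>. Closedness puts the outer limit inside the
  epigraph of \<open>\<psi>\<close>, and \<open>\<psi>\<^sup>\<epsilon> \<le> \<psi>\<close> puts the epigraph of \<open>\<psi>\<close> inside the inner limit. The
  perturbed \<open>\<psi>\<^sup>\<epsilon>\<close> is continuous because \<open>K(x) + \<epsilon> I\<close> is bounded below by \<open>\<epsilon> I\<close>.\<close>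

section \<open>Norm bounds and continuity of the matrix-vector product\<close>

lemma norm_matrix_vector_mult_le:
  fixes M :: "real ^ 'n ^ 'm"
  shows "norm (M *v w) \<le> norm M * norm w"
proof -
  \<comment> \<open>Cauchy-Schwarz is applied row by row; \<open>norm M\<close> is the Euclidean
    norm of the row norms, i.e. the Frobenius norm.\<close>
  have "norm (M *v w) = L2_set (\<lambda>i. \<bar>M $ i \<bullet> w\<bar>) UNIV"
    by (simp add: norm_vec_def matrix_mult_dot)
  also have "\<dots> \<le> L2_set (\<lambda>i. norm (M $ i) * norm w) UNIV"
    by (intro L2_set_mono Cauchy_Schwarz_ineq2) auto
  also have "\<dots> = norm M * norm w"
    by (simp add: norm_vec_def L2_set_left_distrib)
  finally show ?thesis .
qed

lemma bounded_bilinear_matrix_vector_mult: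
  "bounded_bilinear ((*v) :: real ^ 'n ^ 'm \<Rightarrow> real ^ 'n \<Rightarrow> real ^ 'm)"
proof
  show "\<exists>B. \<forall>M w. norm ((M :: real ^ 'n ^ 'm) *v w) \<le> norm M * norm w * B"
    by (rule exI[of _ 1]) (simp add: norm_matrix_vector_mult_le)
qed (simp_all add: matrix_vector_mult_add_rdistrib matrix_vector_right_distrib
      scaleR_matrix_vector_assoc matrix_vector_mult_scaleR)

lemmas continuous_on_matrix_vector_mult [continuous_intros] =
  bounded_bilinear.continuous_on[OF bounded_bilinear_matrix_vector_mult]

lemmas tendsto_matrix_vector_mult [tendsto_intros] =
  bounded_bilinear.tendsto[OF bounded_bilinear_matrix_vector_mult]

lemma abs_quadratic_form_le:
  fixes M :: "real ^ 'n ^ 'n"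
  shows "\<bar>v \<bullet> (M *v v)\<bar> \<le> norm M * (v \<bullet> v)"
proof -
  have "\<bar>v \<bullet> (M *v v)\<bar> \<le> norm v * norm (M *v v)"
    by (rule Cauchy_Schwarz_ineq2)
  also have "\<dots> \<le> norm v * (norm M * norm v)"
    by (intro mult_left_mono norm_matrix_vector_mult_le) auto
  finally show ?thesis
    by (simp add: dot_square_norm power2_eq_square mult_ac)
qed

lemma quadratic_form_add_scaleR_mat_1:
  fixes M :: "real ^ 'n ^ 'n"
  shows "v \<bullet> ((M + e *\<^sub>R mat 1) *v v) = v \<bullet> (M *v v) + e * (v \<bullet> v)"
  by (simp add: matrix_vector_mult_add_rdistrib inner_add_right flip: scaleR_matrix_vector_assoc)

section \<open>Positive semidefinite forms and upper bounds on \<open>lambda_max\<close>\<close>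

lemma psd_nonneg: "psd A \<Longrightarrow> 0 \<le> v \<bullet> (A *v v)"
  by (simp add: psd_def)

lemma psd_inner_commute:
  assumes "psd A"
  shows "v \<bullet> (A *v w) = w \<bullet> (A *v v)"
proof -
  have "v \<bullet> (A *v w) = (transpose A *v v) \<bullet> w"
    by (simp add: dot_lmul_matrix)
  with assms show ?thesis
    by (simp add: psd_def inner_commute)
qed

text \<open>A nonnegative form that vanishes at v cannot have a nonzero slope there: along v + t A v
  it equals 2 t p + t^2 q with p = |A v|^2, which would be negative for small t < 0 if p >
  0.\<close>

lemma psd_quadratic_form_eq_0_iff:
  fixes A :: "real ^ 'n ^ 'n"
  assumes A: "psd A"
  shows "v \<bullet> (A *v v) = 0 \<longleftrightarrow> A *v v = 0"
proof
  assume v: "v \<bullet> (A *v v) = 0"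
  define w where "w = A *v v"
  define p where "p = w \<bullet> w"
  define q where "q = w \<bullet> (A *v w)"
  have q: "0 \<le> q"
    unfolding q_def using A by (rule psd_nonneg)
  have expand: "(v + t *\<^sub>R w) \<bullet> (A *v (v + t *\<^sub>R w)) = 2 * t * p + t\<^sup>2 * q" for t
    using v psd_inner_commute[OF A, of v w]
    by (simp add: matrix_vector_right_distrib matrix_vector_mult_scaleR inner_add_left
        inner_add_right w_def[symmetric] p_def q_def power2_eq_square algebra_simps)
  \<comment> \<open>The minimiser would be - p / q; the added 1 keeps the denominator positive when
    q = 0, and the value stays negative unless p = 0.\<close>
  define t where "t = - p / (q + 1)"
  have "0 \<le> 2 * t * p + t\<^sup>2 * q"
    using psd_nonneg[OF A, of "v + t *\<^sub>R w"] expand by simp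
  also have "2 * t * p + t\<^sup>2 * q = - (p\<^sup>2 * (q + 2) / (q + 1)\<^sup>2)"
    using q by (simp add: t_def divide_simps power2_eq_square) (simp add: algebra_simps)
  finally have "p\<^sup>2 * (q + 2) / (q + 1)\<^sup>2 \<le> 0"
    by simp
  then have "p = 0"
    using q by (simp add: divide_le_0_iff mult_le_0_iff)
  then show "A *v v = 0"
    by (simp add: p_def w_def)
qed simp

lemma psd_eq_0_iff:
  fixes A :: "real ^ 'n ^ 'n"
  assumes "psd A"
  shows "A = 0 \<longleftrightarrow> (\<forall>v. v \<bullet> (A *v v) = 0)"
  by (auto simp: psd_quadratic_form_eq_0_iff[OF assms] matrix_eq)

text \<open>For Y = 0 both sides fail, since A \<noteq> 0 has a vector with positive form. Otherwise
  clearing the positive denominators gives the inequality off the kernel, and it extends to the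
  kernel by continuity.\<close>

lemma lambda_max_le_iff:
  fixes A Y :: "real ^ 'n ^ 'n"
  assumes A: "psd A" "A \<noteq> 0" and Y: "psd Y"
  shows "lambda_max A Y \<le> ereal \<alpha> \<longleftrightarrow> (\<forall>v. v \<bullet> (A *v v) \<le> \<alpha> * (v \<bullet> (Y *v v)))"
proof (cases "Y = 0")
  case True
  from A obtain v where "v \<bullet> (A *v v) \<noteq> 0"
    by (auto simp: psd_eq_0_iff)
  with psd_nonneg[OF A(1), of v] have "0 < v \<bullet> (A *v v)"
    by simp
  with True A(2) show ?thesis
    by (auto simp: lambda_max_def not_le)
next
  case False
  have pos: "0 < v \<bullet> (Y *v v)" if "Y *v v \<noteq> 0" for v
    using psd_quadratic_form_eq_0_iff[OF Y] psd_nonneg[OF Y] that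
    by (metis order_le_imp_less_or_eq)
  have "lambda_max A Y \<le> ereal \<alpha> \<longleftrightarrow>
      (\<forall>v. Y *v v \<noteq> 0 \<longrightarrow> v \<bullet> (A *v v) \<le> \<alpha> * (v \<bullet> (Y *v v)))"
    using False pos by (auto simp: lambda_max_def SUP_le_iff Ker_def divide_le_eq)
  also have "\<dots> \<longleftrightarrow> (\<forall>v. v \<bullet> (A *v v) \<le> \<alpha> * (v \<bullet> (Y *v v)))"
  proof (intro iffI allI impI)
    fix u
    assume *: "\<forall>v. Y *v v \<noteq> 0 \<longrightarrow> v \<bullet> (A *v v) \<le> \<alpha> * (v \<bullet> (Y *v v))"
    show "u \<bullet> (A *v u) \<le> \<alpha> * (u \<bullet> (Y *v u))"
    proof (cases "Y *v u = 0")
      case u: True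
      from False obtain w where w: "Y *v w \<noteq> 0"
        by (auto simp: matrix_eq)
      \<comment> \<open>Approach \<open>u\<close> by the vectors \<open>u + s w\<close>, which lie outside the kernel for \<open>s \<noteq> 0\<close>.\<close>
      define g where
        "g s = \<alpha> * ((u + s *\<^sub>R w) \<bullet> (Y *v (u + s *\<^sub>R w))) - (u + s *\<^sub>R w) \<bullet> (A *v (u + s *\<^sub>R w))"
        for s :: real
      have "(g \<longlongrightarrow> g 0) (at 0)"
        unfolding g_def by (intro tendsto_intros)
      moreover have "0 \<le> g s" if "s \<noteq> 0" for s
      proof -
        have "Y *v (u + s *\<^sub>R w) \<noteq> 0"
          using u w that by (simp add: matrix_vector_right_distrib matrix_vector_mult_scaleR)
        with * show ?thesis
          by (simp add: g_def)
      qed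
      then have "\<forall>\<^sub>F s in at 0. 0 \<le> g s"
        by (simp add: eventually_at_filter)
      ultimately have "0 \<le> g 0"
        by (intro tendsto_lowerbound) auto
      then show ?thesis
        by (simp add: g_def)
    qed (use * in blast)
  qed blast
  finally show ?thesis .
qed

section \<open>Distances to sets and Painleve-Kuratowski limits\<close>

lemma dist_set_nonneg: "0 \<le> dist_set z C"
  by (simp add: dist_set_def INF_greatest)

lemma dist_set_eq_0: "z \<in> C \<Longrightarrow> dist_set z C = 0"
  by (intro antisym dist_set_nonneg) (auto simp: dist_set_def intro: INF_lower2)

lemma inner_limit_subset_outer_limit: "inner_limit C \<subseteq> outer_limit C"
proof
  fix z assume "z \<in> inner_limit C"
  then have "liminf (\<lambda>k. dist_set z (C k)) \<le> 0"
    using Liminf_le_Limsup[of sequentially "\<lambda>k. dist_set z (C k)"] by (simp add: inner_limit_def)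
  moreover have "0 \<le> liminf (\<lambda>k. dist_set z (C k))"
    by (intro Liminf_bounded always_eventually) (simp add: dist_set_nonneg)
  ultimately show "z \<in> outer_limit C"
    by (simp add: outer_limit_def)
qed

lemma inner_limit_superset:
  assumes "\<And>k. D \<subseteq> C k"
  shows "D \<subseteq> inner_limit C"
proof
  fix z assume "z \<in> D"
  then have "(\<lambda>k. dist_set z (C k)) = (\<lambda>k. 0)"
    using assms by (intro ext dist_set_eq_0) auto
  then show "z \<in> inner_limit C"
    by (simp add: inner_limit_def Limsup_const)
qed

text \<open>Were the distance eventually at least d, the lower limit would be too. An empty
  \<open>C k\<close> counts as far away, its distance being \<infinity>.\<close>

lemma outer_limit_frequently_close:
  assumes "z \<in> outer_limit C" and "0 < d"
  shows "\<exists>\<^sub>F k in sequentially. \<exists>y\<in>C k. dist z y < d"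
proof (rule ccontr)
  assume "\<not> ?thesis"
  then have "\<forall>\<^sub>F k in sequentially. ereal d \<le> dist_set z (C k)"
    by (auto simp: not_frequently not_less dist_set_def le_INF_iff elim!: eventually_mono)
  then have "ereal d \<le> liminf (\<lambda>k. dist_set z (C k))"
    by (rule Liminf_bounded)
  with assms show False
    by (simp add: outer_limit_def)
qed

text \<open>Points of the slices close to z, paired with parameters close to \<open>e0\<close>, are
  points of \<open>F\<close> arbitrarily close to (z, \<open>e0\<close>).\<close>

lemma outer_limit_slices_subset:
  fixes F :: "('a::metric_space \<times> 'b::metric_space) set"
  assumes F: "closed F" and e: "e \<longlonglongrightarrow> e0"
  shows "outer_limit (\<lambda>k. {y. (y, e k) \<in> F}) \<subseteq> {y. (y, e0) \<in> F}"
proof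
  fix z assume z: "z \<in> outer_limit (\<lambda>k. {y. (y, e k) \<in> F})"
  have "\<exists>p\<in>F. dist p (z, e0) < d" if "0 < d" for d
  proof -
    have "\<forall>\<^sub>F k in sequentially. dist (e k) e0 < d / 2"
      using tendstoD[OF e half_gt_zero[OF that]] .
    with outer_limit_frequently_close[OF z half_gt_zero[OF that]]
    have "\<exists>\<^sub>F k in sequentially. (\<exists>y. (y, e k) \<in> F \<and> dist z y < d / 2) \<and> dist (e k) e0 < d / 2"
      by (auto dest: frequently_eventually_frequently)
    then obtain k y where y: "(y, e k) \<in> F" "dist z y < d / 2" "dist (e k) e0 < d / 2"
      by (blast dest: frequently_ex)
    have "dist (y, e k) (z, e0) \<le> dist y z + dist (e k) e0"
      unfolding dist_Pair_Pair by (rule sqrt_sum_squares_le_sum) auto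
    with y show ?thesis
      by (intro bexI[of _ "(y, e k)"]) (auto simp: dist_commute)
  qed
  then have "(z, e0) \<in> closure F"
    by (simp add: closure_approachable)
  with F show "z \<in> {y. (y, e0) \<in> F}"
    by simp
qed

section \<open>The forms of Q Q^T and K(x) + \<epsilon> I, and the resulting epigraphs\<close>

lemma closed_nonneg_vecs: "closed (nonneg_vecs :: (real ^ 'm) set)"
  unfolding nonneg_vecs_def by (intro closed_Collect_all closed_Collect_le continuous_intros)

lemma mult_transpose_quadratic_form:
  fixes Q :: "real ^ 'd ^ 'n"
  shows "v \<bullet> ((Q ** transpose Q) *v v) = (transpose Q *v v) \<bullet> (transpose Q *v v)"
  by (simp add: dot_lmul_matrix flip: matrix_vector_mul_assoc)

lemma psd_mult_transpose:
  fixes Q :: "real ^ 'd ^ 'n"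
  shows "psd (Q ** transpose Q)"
  unfolding psd_def mult_transpose_quadratic_form by (simp add: matrix_transpose_mul)

lemma mult_transpose_eq_0_iff:
  fixes Q :: "real ^ 'd ^ 'n"
  shows "Q ** transpose Q = 0 \<longleftrightarrow> Q = 0"
proof -
  have "Q ** transpose Q = 0 \<longleftrightarrow> transpose Q = 0"
    unfolding psd_eq_0_iff[OF psd_mult_transpose] mult_transpose_quadratic_form
    by (auto simp: matrix_eq)
  also have "\<dots> \<longleftrightarrow> Q = 0"
    by (auto simp: transpose_def vec_eq_iff)
  finally show ?thesis .
qed

lemma psd_add_scaleR_mat_1:
  assumes "psd A" and "0 \<le> e"
  shows "psd (A + e *\<^sub>R mat 1)"
proof -
  have "transpose (A + e *\<^sub>R mat 1) = transpose A + e *\<^sub>R mat 1"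
    by (auto simp: transpose_def vec_eq_iff mat_def)
  with assms show ?thesis
    unfolding psd_def quadratic_form_add_scaleR_mat_1 by simp
qed

text \<open>For each fixed v both sides are continuous in (x, \<alpha>, \<epsilon>) on a closed
  domain, and an intersection of closed sets over all v is closed.\<close>

lemma closed_perturbed_epi:
  fixes K :: "real ^ 'm \<Rightarrow> real ^ 'n ^ 'n" and A :: "real ^ 'n ^ 'n"
  assumes "continuous_on nonneg_vecs K"
  shows "closed {((x, \<alpha>), \<epsilon>). x \<in> nonneg_vecs \<and> 0 \<le> \<epsilon> \<and>
    (\<forall>v. v \<bullet> (A *v v) \<le> \<alpha> * (v \<bullet> ((K x + \<epsilon> *\<^sub>R mat 1) *v v)))}"
proof -
  define S :: "(((real ^ 'm) \<times> real) \<times> real) set" where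
    "S = (nonneg_vecs \<times> UNIV) \<times> {0..}"
  have S: "closed S"
    unfolding S_def by (intro closed_Times closed_nonneg_vecs closed_UNIV closed_atLeast)
  have "continuous_on S (\<lambda>p. K (fst (fst p)))"
    by (rule continuous_on_compose2[OF assms]) (auto simp: S_def intro!: continuous_intros)
  then have "closed {p \<in> S. v \<bullet> (A *v v)
      \<le> snd (fst p) * (v \<bullet> ((K (fst (fst p)) + snd p *\<^sub>R mat 1) *v v))}" for v
    by (intro continuous_on_closed_Collect_le S continuous_intros)
  then have "closed (\<Inter>v. {p \<in> S. v \<bullet> (A *v v)
      \<le> snd (fst p) * (v \<bullet> ((K (fst (fst p)) + snd p *\<^sub>R mat 1) *v v))})"
    by blast
  also have "(\<Inter>v. {p \<in> S. v \<bullet> (A *v v)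
      \<le> snd (fst p) * (v \<bullet> ((K (fst (fst p)) + snd p *\<^sub>R mat 1) *v v))}) =
    {((x, \<alpha>), \<epsilon>). x \<in> nonneg_vecs \<and> 0 \<le> \<epsilon> \<and>
      (\<forall>v. v \<bullet> (A *v v) \<le> \<alpha> * (v \<bullet> ((K x + \<epsilon> *\<^sub>R mat 1) *v v)))}"
    by (auto simp: S_def)
  finally show ?thesis .
qed

lemma psi_eps_le_iff:
  fixes Q :: "real ^ 'd ^ 'n"
  assumes "Q \<noteq> 0" and "psd (K x)" and "0 \<le> \<epsilon>"
  shows "psi_eps Q K \<epsilon> x \<le> ereal \<alpha> \<longleftrightarrow> (\<forall>v. v \<bullet> ((Q ** transpose Q) *v v)
    \<le> \<alpha> * (v \<bullet> ((K x + \<epsilon> *\<^sub>R mat 1) *v v)))"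
  unfolding psi_eps_def using assms
  by (intro lambda_max_le_iff psd_mult_transpose psd_add_scaleR_mat_1)
    (auto simp: mult_transpose_eq_0_iff)

text \<open>Makes \<open>psi\<close> the case \<epsilon> = 0, so that \<open>psi_eps_le_iff\<close>
  and the slice at 0 cover it.\<close>

lemma psi_eps_0: "psi_eps Q K 0 = psi Q K"
  by (simp add: fun_eq_iff psi_eps_def psi_def)

text \<open>Every real upper bound \<alpha> of \<open>psi\<close> also bounds
  \<open>psi_eps\<close>: adding \<epsilon> I increases the right-hand side by \<alpha> \<epsilon>
  |v|^2, which is nonnegative once \<alpha> \<ge> 0.\<close>

lemma psi_eps_le_psi:
  fixes Q :: "real ^ 'd ^ 'n"
  assumes Q: "Q \<noteq> 0" and K: "psd (K x)" and \<epsilon>: "0 \<le> \<epsilon>"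
  shows "psi_eps Q K \<epsilon> x \<le> psi Q K x"
proof (rule ereal_le_real)
  fix \<alpha> assume "psi Q K x \<le> ereal \<alpha>"
  then have *: "v \<bullet> ((Q ** transpose Q) *v v) \<le> \<alpha> * (v \<bullet> (K x *v v))" for v
    using psi_eps_le_iff[of Q K x 0, OF Q K] by (simp add: psi_eps_0)
  \<comment> \<open>Q \<noteq> 0 gives a w at which the left-hand form is positive, which rules out
    \<alpha> < 0.\<close>
  from Q obtain w where "w \<bullet> ((Q ** transpose Q) *v w) \<noteq> 0"
    using psd_eq_0_iff[OF psd_mult_transpose] mult_transpose_eq_0_iff by blast
  then have "0 < w \<bullet> ((Q ** transpose Q) *v w)"
    using psd_nonneg[OF psd_mult_transpose, of w Q] by simp
  also note *[of w]
  finally have \<alpha>: "0 \<le> \<alpha>"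
    using psd_nonneg[OF K, of w] by (simp add: zero_less_mult_iff)
  have "v \<bullet> ((Q ** transpose Q) *v v) \<le> \<alpha> * (v \<bullet> ((K x + \<epsilon> *\<^sub>R mat 1) *v v))" for v
  proof -
    have "0 \<le> \<alpha> * (\<epsilon> * (v \<bullet> v))"
      using \<alpha> \<epsilon> by simp
    with *[of v] show ?thesis
      by (simp add: quadratic_form_add_scaleR_mat_1 distrib_left)
  qed
  then show "psi_eps Q K \<epsilon> x \<le> ereal \<alpha>"
    by (simp add: psi_eps_le_iff[of Q K x, OF Q K \<epsilon>])
qed

section \<open>Continuity for fixed \<epsilon> > 0\<close>

lemma continuous_on_psi_eps:
  fixes K :: "real ^ 'm \<Rightarrow> real ^ 'n ^ 'n" and Q :: "real ^ 'd ^ 'n"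
  assumes cont: "continuous_on nonneg_vecs K"
    and K: "\<And>x. x \<in> nonneg_vecs \<Longrightarrow> psd (K x)"
    and Q: "Q \<noteq> 0" and \<epsilon>: "0 < \<epsilon>"
  shows "continuous_on nonneg_vecs (psi_eps Q K \<epsilon>)"
  unfolding continuous_on_def
proof (intro ballI order_tendstoI)
  fix x :: "real ^ 'm" and a :: ereal
  assume x: "x \<in> nonneg_vecs"
  have lim: "(K \<longlongrightarrow> K x) (at x within nonneg_vecs)"
    using cont x by (simp add: continuous_on_def)
  note le_iff = psi_eps_le_iff[of Q K, OF Q K less_imp_le[OF \<epsilon>]]
  {
    \<comment> \<open>Lower semicontinuity: one vector v witnesses the failure of the bound \<alpha>
      at x, and the same v works at all nearby y.\<close>
    assume "a < psi_eps Q K \<epsilon> x"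
    then obtain \<alpha> where \<alpha>: "a < ereal \<alpha>" "ereal \<alpha> < psi_eps Q K \<epsilon> x"
      using ereal_dense2 by blast
    then obtain v where
      "\<alpha> * (v \<bullet> ((K x + \<epsilon> *\<^sub>R mat 1) *v v)) < v \<bullet> ((Q ** transpose Q) *v v)"
      using le_iff[OF x, of \<alpha>] by (auto simp: not_le[symmetric])
    moreover have "((\<lambda>y. \<alpha> * (v \<bullet> ((K y + \<epsilon> *\<^sub>R mat 1) *v v))) \<longlongrightarrow>
        \<alpha> * (v \<bullet> ((K x + \<epsilon> *\<^sub>R mat 1) *v v))) (at x within nonneg_vecs)"
      by (intro tendsto_intros lim)
    ultimately have "\<forall>\<^sub>F y in at x within nonneg_vecs.
        \<alpha> * (v \<bullet> ((K y + \<epsilon> *\<^sub>R mat 1) *v v)) < v \<bullet> ((Q ** transpose Q) *v v)"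
      by (rule order_tendstoD(2)[rotated])
    moreover have "\<forall>\<^sub>F y in at x within nonneg_vecs. y \<in> nonneg_vecs"
      by (simp add: eventually_at_filter)
    ultimately show "\<forall>\<^sub>F y in at x within nonneg_vecs. a < psi_eps Q K \<epsilon> y"
    proof eventually_elim
      case (elim y)
      then have "\<not> psi_eps Q K \<epsilon> y \<le> ereal \<alpha>"
        using le_iff[OF elim(2), of \<alpha>] by (auto simp: not_le)
      with \<alpha>(1) show ?case
        by (simp add: not_le)
    qed
  next
    assume "psi_eps Q K \<epsilon> x < a"
    then obtain \<beta> where \<beta>: "psi_eps Q K \<epsilon> x < ereal \<beta>" "ereal \<beta> < a"
      using ereal_dense2 by blast
    \<comment> \<open>Upper semicontinuity needs a bound uniform in v. The gap between the levels
      \<alpha> < \<beta> gives the slack (\<beta> - \<alpha>) \<epsilon> |v|^2, which absorbs the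
      change from K(x) to K(y).\<close>
    then obtain \<alpha> where \<alpha>: "psi_eps Q K \<epsilon> x < ereal \<alpha>" "\<alpha> < \<beta>"
      using ereal_dense2[OF \<beta>(1)] by auto
    have A: "v \<bullet> ((Q ** transpose Q) *v v) \<le> \<alpha> * (v \<bullet> ((K x + \<epsilon> *\<^sub>R mat 1) *v v))" for v
      using le_iff[OF x, of \<alpha>] \<alpha>(1) by (simp add: less_imp_le)
    have "((\<lambda>y. \<bar>\<beta>\<bar> * norm (K y - K x)) \<longlongrightarrow> \<bar>\<beta>\<bar> * norm (K x - K x))
        (at x within nonneg_vecs)"
      by (intro tendsto_intros lim)
    moreover have "\<bar>\<beta>\<bar> * norm (K x - K x) < (\<beta> - \<alpha>) * \<epsilon>"
      using \<alpha>(2) \<epsilon> by simp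
    ultimately have "\<forall>\<^sub>F y in at x within nonneg_vecs. \<bar>\<beta>\<bar> * norm (K y - K x) < (\<beta> - \<alpha>) * \<epsilon>"
      by (rule order_tendstoD(2))
    moreover have "\<forall>\<^sub>F y in at x within nonneg_vecs. y \<in> nonneg_vecs"
      by (simp add: eventually_at_filter)
    ultimately show "\<forall>\<^sub>F y in at x within nonneg_vecs. psi_eps Q K \<epsilon> y < a"
    proof eventually_elim
      case (elim y)
      have "v \<bullet> ((Q ** transpose Q) *v v) \<le> \<beta> * (v \<bullet> ((K y + \<epsilon> *\<^sub>R mat 1) *v v))" for v
      proof -
        have "\<bar>\<beta> * (v \<bullet> ((K y - K x) *v v))\<bar> \<le> \<bar>\<beta>\<bar> * (norm (K y - K x) * (v \<bullet> v))"
          unfolding abs_mult by (intro mult_left_mono abs_quadratic_form_le) auto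
        also have "\<dots> \<le> (\<beta> - \<alpha>) * \<epsilon> * (v \<bullet> v)"
          using mult_right_mono[OF less_imp_le[OF elim(1)], of "v \<bullet> v"] by (simp add: mult.assoc)
        finally have "- ((\<beta> - \<alpha>) * \<epsilon> * (v \<bullet> v)) \<le> \<beta> * (v \<bullet> ((K y - K x) *v v))"
          by linarith
        moreover have "0 \<le> (\<beta> - \<alpha>) * (v \<bullet> (K x *v v))"
          using \<alpha>(2) psd_nonneg[OF K[OF x]] by simp
        \<comment> \<open>The right-hand side is the bound at x with \<alpha>, plus (\<beta> -
          \<alpha>) times the form of K(x) + \<epsilon> I, plus \<beta> times the form of K(y) -
          K(x).\<close>
        ultimately show ?thesis
          using A[of v] unfolding quadratic_form_add_scaleR_mat_1
          by (simp add: matrix_vector_mult_diff_rdistrib inner_diff_right algebra_simps)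
      qed
      then have "psi_eps Q K \<epsilon> y \<le> ereal \<beta>"
        using le_iff[OF elim(2)] by simp
      with \<beta>(2) show ?case
        by simp
    qed
  }
qed

section \<open>Epi-convergence as \<epsilon> tends to 0\<close>

theorem theorem10:
  fixes K :: "real ^ 'm \<Rightarrow> real ^ 'n ^ 'n" and Q :: "real ^ 'd ^ 'n"
  assumes "continuous_on nonneg_vecs K"
    and "\<And>x. x \<in> nonneg_vecs \<Longrightarrow> psd (K x)"
    and "\<And>x. x \<in> pos_vecs \<Longrightarrow> posdef (K x)"
    and "Q \<noteq> 0"
  shows "(\<forall>\<epsilon>>0. continuous_on nonneg_vecs (psi_eps Q K \<epsilon>)) \<and>
    epi_converges_at_0 (\<lambda>\<epsilon>. extend_infty nonneg_vecs (psi_eps Q K \<epsilon>))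
      (extend_infty nonneg_vecs (psi Q K))"
proof
  show "\<forall>\<epsilon>>0. continuous_on nonneg_vecs (psi_eps Q K \<epsilon>)"
    using continuous_on_psi_eps[of K Q] assms(1,2,4) by simp
next
  define F where "F = {((x, \<alpha>), \<epsilon>). x \<in> nonneg_vecs \<and> 0 \<le> \<epsilon> \<and>
    (\<forall>v. v \<bullet> ((Q ** transpose Q) *v v) \<le> \<alpha> * (v \<bullet> ((K x + \<epsilon> *\<^sub>R mat 1) *v v)))}"
  have F: "closed F"
    unfolding F_def using assms(1) by (rule closed_perturbed_epi)
  \<comment> \<open>Outside \<open>nonneg_vecs\<close> the value \<infinity> leaves no real \<alpha>
    in the epigraph. The case \<epsilon> = 0 is included to cover \<open>psi\<close>.\<close>
  have epi: "epi (extend_infty nonneg_vecs (psi_eps Q K \<epsilon>)) = {y. (y, \<epsilon>) \<in> F}"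
    if "0 \<le> \<epsilon>" for \<epsilon>
    using that psi_eps_le_iff[of Q K, OF assms(4,2)]
    by (auto simp: epi_def extend_infty_def F_def split: if_splits)
  show "epi_converges_at_0 (\<lambda>\<epsilon>. extend_infty nonneg_vecs (psi_eps Q K \<epsilon>))
      (extend_infty nonneg_vecs (psi Q K))"
    unfolding epi_converges_at_0_def epi_converges_def
  proof (intro allI impI)
    fix e :: "nat \<Rightarrow> real"
    assume "(\<forall>k. 0 < e k) \<and> e \<longlonglongrightarrow> 0"
    then have e: "0 \<le> e k" and lim: "e \<longlonglongrightarrow> 0" for k
      by (auto intro: less_imp_le)
    let ?C = "\<lambda>k. epi (extend_infty nonneg_vecs (psi_eps Q K (e k)))"
    let ?D = "epi (extend_infty nonneg_vecs (psi Q K))"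
    have "outer_limit ?C \<subseteq> ?D"
      using outer_limit_slices_subset[OF F lim] epi[of 0] by (simp add: epi e psi_eps_0)
    moreover have "?D \<subseteq> inner_limit ?C"
    proof (rule inner_limit_superset)
      show "?D \<subseteq> ?C k" for k
        using psi_eps_le_psi[of Q K, OF assms(4,2) e]
        by (fastforce simp: epi_def extend_infty_def intro: order_trans split: if_splits)
    qed
    \<comment> \<open>The cycle D, inner limit, outer limit, D of inclusions makes all three sets
      equal.\<close>
    ultimately show "PK_converges ?C ?D"
      using inner_limit_subset_outer_limit[of ?C] unfolding PK_converges_def by blast
  qed
qed

end
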